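(* Let $1<\sigma<2$, $T>0$, $b\in\mathbb{R}$ with $b\neq 0$, and let $T_0^*=\min\{T_0,1\}$, where $T_0$ is the existence time defined in the context. Let $f$ be such that $f(x,t_1,t_2)\in C\big((0,T]\times\mathbb{R}\times\mathbb{R}\big)$ and $x^{\sigma-1}f(x,t_1,t_2)\in C\big([0,T]\times\mathbb{R}\times\mathbb{R}\big)$. Suppose that there exists $L>0$ such that $$x^{\sigma-1}\left|f(x,t_{1,1},t_{2,1})-f(x,t_{1,2},t_{2,2})\right|\leq \frac{L}{2}\left(\left|t_{1,1}-t_{1,2}\right|+\left|t_{2,1}-t_{2,2}\right|\right)$$ holds for all $x\in[0,T]$ and all $t_{1,i},t_{2,i}\in\mathbb{R}$ with $i=1,2$, and that there exist $C>0$ and $\alpha\in(0,1)$ satisfying $(1-\sigma)(1-\alpha)-L(1-\alpha)+1>0$ such that $$x^{\sigma-1}\left|f(x,t_{1,1},t_{2,1})-f(x,t_{1,2},t_{2,2})\right|\leq C\left(\left|t_{1,1}-t_{1,2}\right|^{\alpha}+x^{\alpha(\sigma-1)}\left|t_{2,1}-t_{2,2}\right|^{\alpha}\right)$$ holds for all $x\in[0,T]$ and all $t_{1,i},t_{2,i}\in\mathbb{R}$ with $i=1,2$. Then the initial value problem $$D^{\sigma}\omega(x)=f\big(x,\omega(x),D^{\sigma-1}\omega(x)\big),\quad x>0,\qquad \omega(0)=0,\quad D^{\sigma-1}\omega(x)|_{x=0}=b,$$ has a unique solution in the space $C^{\sigma-1}([0,T_0^*])$.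
   Context: $C(X)$ denotes the class of continuous functions on $X$; the condition $x^{\sigma-1}f\in C([0,T]\times\mathbb{R}\times\mathbb{R})$ means that $(x,t_1,t_2)\mapsto x^{\sigma-1}f(x,t_1,t_2)$ extends continuously to $x=0$, and at $x=0$ such expressions are understood via this extension. For $1<\sigma<2$, the Riemann-Liouville derivatives (lower terminal $0$) are $$D^{\sigma}\omega(x)=\frac{1}{\Gamma(2-\sigma)}\frac{d^2}{dx^2}\int_0^x\frac{\omega(t)}{(x-t)^{\sigma-1}}dt,\qquad D^{\sigma-1}\omega(x)=\frac{1}{\Gamma(2-\sigma)}\frac{d}{dx}\int_0^x\frac{\omega(t)}{(x-t)^{\sigma-1}}dt.$$ For $0<\beta<1$ and $a>0$, $C^{\beta}([0,a])$ is the space of continuous functions on $[0,a]$ whose Riemann-Liouville derivative $D^{\beta}\omega$ is continuous on $[0,a]$, with norm $\|\omega\|_\infty+\|D^\beta\omega\|_\infty$. Existence time $T_0$: let $r,\mathcal{M}>0$ be such that $|x^{\sigma-1}f(x,w,v)|\le\mathcal{M}$ for all $(x,w,v)\in[0,T]\times[-r_1,r_1]\times[b-r_2,b+r_2]$ with $r_1+r_2\le r$. Put $C(b,\sigma,\mathcal{M})=\frac{|b|}{\Gamma(\sigma)}+\mathcal{M}\left(\frac{1+\Gamma(3-\sigma)}{2-\sigma}\right)$ and $\rho=r/C(b,\sigma,\mathcal{M})$. Then $$T_0=\begin{cases}T & \text{if } T<\rho,\\ \rho & \text{if } T\ge\rho\ge1,\\ \rho^{\sigma-1} & \text{if } T\ge\rho,\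 1\ge\rho \text{ and } 1<\sigma\le1.5,\\ \rho^{2-\sigma} & \text{if } T\ge\rho,\ 1\ge\rho\text{ and } 1.5\le\sigma<2.\end{cases}$$
   Formalization: The solution is taken on [0, min{T_0^*, T}] instead of [0, T_0^*]: T_0^* can exceed T (e.g. σ=1.2, T=ρ=1/2 gives T_0≈0.87), and f is given only for x ≤ T, so the equation is undefined on (T, T_0^*]. *)

theory Defs
  imports "HOL-Analysis.Analysis"
begin

definition RL_integral :: "real \<Rightarrow> (real \<Rightarrow> real) \<Rightarrow> real \<Rightarrow> real" where
  "RL_integral \<beta> \<omega> x = integral {0..x} (\<lambda>t. \<omega> t / (x - t) powr \<beta>)"

(* Functions live on [0,a], so all derivatives are taken within [0,a]: they are
   one-sided at the two end points. *)

definition RL_deriv :: "real \<Rightarrow> real \<Rightarrow> (real \<Rightarrow> real) \<Rightarrow> real \<Rightarrow> real" where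
  "RL_deriv \<beta> a \<omega> x =
     1 / Gamma (1 - \<beta>) * vector_derivative (RL_integral \<beta> \<omega>) (at x within {0..a})"

(* Order sigma in (1,2). The differentiability that makes the value meaningful is
   required separately in RL_deriv2_exists. *)
definition RL_deriv2 :: "real \<Rightarrow> real \<Rightarrow> (real \<Rightarrow> real) \<Rightarrow> real \<Rightarrow> real" where
  "RL_deriv2 \<sigma> a \<omega> x =
     1 / Gamma (2 - \<sigma>) *
       vector_derivative
         (\<lambda>y. vector_derivative (RL_integral (\<sigma> - 1) \<omega>) (at y within {0..a}))
         (at x within {0..a})"

definition RL_deriv2_exists :: "real \<Rightarrow> real \<Rightarrow> (real \<Rightarrow> real) \<Rightarrow> real \<Rightarrow> bool" where
  "RL_deriv2_exists \<sigma> a \<omega> x \<longleftrightarrow>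
     (\<lambda>y. vector_derivative (RL_integral (\<sigma> - 1) \<omega>) (at y within {0..a}))
       differentiable (at x within {0..a})"

(* The space C^beta([0,a]), 0 < beta < 1. Elements are total functions of which only
   the values on [0,a] matter. *)
definition C_RL :: "real \<Rightarrow> real \<Rightarrow> (real \<Rightarrow> real) set" where
  "C_RL \<beta> a = {\<omega>. continuous_on {0..a} \<omega> \<and>
                  (\<forall>x\<in>{0..a}. RL_integral \<beta> \<omega> differentiable (at x within {0..a})) \<and>
                  continuous_on {0..a} (RL_deriv \<beta> a \<omega>)}"

(* x^(sigma-1) f(x,t1,t2), with the value at x = 0 given by the limit. This function is
   continuous on [0,T] x R x R iff x^(sigma-1) f has some continuous extension there. *)
definition weighted ::
    "real \<Rightarrow> (real \<Rightarrow> real \<Rightarrow> real \<Rightarrow> real) \<Rightarrow> real \<Rightarrow> real \<Rightarrow> real \<Rightarrow> real" where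
  "weighted \<sigma> f x t1 t2 =
     (if x = 0 then Lim (at_right 0) (\<lambda>s. s powr (\<sigma> - 1) * f s t1 t2)
      else x powr (\<sigma> - 1) * f x t1 t2)"

definition C_const :: "real \<Rightarrow> real \<Rightarrow> real \<Rightarrow> real" where
  "C_const b \<sigma> M = \<bar>b\<bar> / Gamma \<sigma> + M * ((1 + Gamma (3 - \<sigma>)) / (2 - \<sigma>))"

(* Where the cases of the definition overlap (rho = 1, sigma = 3/2) their values agree.
   In the last two cases the result can exceed T, since rho^s >= rho for rho <= 1, s <= 1;
   as f is only given for x <= T, the initial value problem is then posed on [0,T]. *)
definition existence_time :: "real \<Rightarrow> real \<Rightarrow> real \<Rightarrow> real \<Rightarrow> real \<Rightarrow> real" where
  "existence_time \<sigma> b T r M =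
     (let \<rho> = r / C_const b \<sigma> M in
        if T < \<rho> then T
        else if \<rho> \<ge> 1 then \<rho>
        else if \<sigma> \<le> 3 / 2 then \<rho> powr (\<sigma> - 1)
        else \<rho> powr (2 - \<sigma>))"

definition T0_star :: "real \<Rightarrow> real \<Rightarrow> real \<Rightarrow> real \<Rightarrow> real \<Rightarrow> real" where
  "T0_star \<sigma> b T r M = min (existence_time \<sigma> b T r M) 1"

definition solves_ivp ::
    "real \<Rightarrow> real \<Rightarrow> (real \<Rightarrow> real \<Rightarrow> real \<Rightarrow> real) \<Rightarrow> real \<Rightarrow> (real \<Rightarrow> real) \<Rightarrow> bool" where
  "solves_ivp \<sigma> b f a \<omega> \<longleftrightarrow>
     (\<forall>x\<in>{0<..a}. RL_deriv2_exists \<sigma> a \<omega> x \<and>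
        RL_deriv2 \<sigma> a \<omega> x = f x (\<omega> x) (RL_deriv (\<sigma> - 1) a \<omega> x)) \<and>
     \<omega> 0 = 0 \<and> RL_deriv (\<sigma> - 1) a \<omega> 0 = b"

end

theory Submission
  imports Defs
begin

text \<open>With \<open>\<beta> = \<sigma> - 1\<close>, the substitution \<open>v = D\<^sup>\<beta> \<omega>\<close>, \<open>\<omega> = I\<^sup>\<beta> v\<close> turns the initial value problem into the
  Volterra equation \<open>v x = b + \<integral>\<^sub>0\<^sup>x t\<^bsup>-\<beta>\<^esup> g(t, I\<^sup>\<beta> v t, v t) dt\<close>, where \<open>g\<close> is the continuous extension of
  \<open>t\<^bsup>\<beta>\<^esup> f\<close>. As \<open>g\<close> is globally Lipschitz in its last two arguments, the right-hand side is a contraction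
  for the supremum norm weighted by \<open>exp (- c t\<^bsup>1-\<beta>\<^esup>)\<close> with \<open>c\<close> large. The two problems are equivalent
  because \<open>I\<^bsup>1-\<beta>\<^esup> I\<^sup>\<beta> h\<close> is the primitive of \<open>h\<close>, for \<open>\<beta>\<close> and for \<open>1-\<beta>\<close>; the latter gives injectivity
  of \<open>I\<^bsup>1-\<beta>\<^esup>\<close>.\<close>

subsection \<open>Fractional integrals of continuous functions\<close>

text \<open>The Riemann-Liouville integral of order \<open>\<gamma>\<close> with lower terminal 0.
  For \<open>\<gamma> < 1\<close> the kernel is singular at \<open>t = x\<close>, where
  \<open>powr\<close> gives the harmless value 0.\<close>

definition frac_int :: "real \<Rightarrow> (real \<Rightarrow> real) \<Rightarrow> real \<Rightarrow> real" where
  "frac_int \<gamma> h x = integral {0..x} (\<lambda>t. (x - t) powr (\<gamma> - 1) * h t) / Gamma \<gamma>"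

lemma Gamma_real_nonzero: "0 < x \<Longrightarrow> Gamma x \<noteq> 0" for x :: real
  using Gamma_real_pos[of x] by (metis less_irrefl)

lemma continuous_on_powr_const:
  fixes p a :: real
  assumes "p > 0"
  shows "continuous_on {0..a} (\<lambda>t. t powr p)"
  using assms by (intro continuous_on_powr') (auto intro: continuous_intros)

text \<open>Euler's Beta integral on \<open>{0..1}\<close> under the substitution
  \<open>t = x * s\<close>, with the powers of \<open>x\<close> collected. For \<open>x = 0\<close>
  both sides vanish, since \<open>0 powr _\<close> is 0.\<close>

lemma has_integral_Beta_scaled:
  fixes p q x :: real
  assumes "p > 0" "q > 0" "x \<ge> 0"
  shows "((\<lambda>t. (x - t) powr (q - 1) * t powr (p - 1)) has_integral Beta p q * x powr (p + q - 1)) {0..x}"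
proof (cases "x = 0")
  case False
  then have x: "x > 0" using assms by simp
  have "((\<lambda>t. (t / x) powr (p - 1) * (1 - t / x) powr (q - 1)) has_integral x * Beta p q) {0..x}"
    using has_integral_stretch_real[OF has_integral_Beta_real[OF assms(1,2)], of "1 / x"] x
      image_mult_atLeastAtMost[of x 0 1]
    by (simp add: mult.commute[of _ x])
  then have "((\<lambda>t. x powr (p + q - 2) * ((t / x) powr (p - 1) * (1 - t / x) powr (q - 1)))
      has_integral x powr (p + q - 2) * (x * Beta p q)) {0..x}"
    by (rule has_integral_mult_right)
  moreover have "x powr (p + q - 2) * (x * Beta p q) = Beta p q * x powr (p + q - 1)"
    using x powr_add[of x "p + q - 2" 1] by (simp add: algebra_simps)
  moreover have "x powr (p + q - 2) * ((t / x) powr (p - 1) * (1 - t / x) powr (q - 1))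
      = (x - t) powr (q - 1) * t powr (p - 1)" if t: "t \<in> {0..x}" for t
  proof -
    have "1 - t / x = (x - t) / x" using x by (simp add: field_simps)
    moreover have "x powr (p + q - 2) = x powr (p - 1) * x powr (q - 1)"
      by (simp add: powr_add[symmetric] algebra_simps)
    ultimately show ?thesis using t x by (simp add: powr_divide)
  qed
  ultimately show ?thesis
    by (metis (mono_tags, lifting) has_integral_eq)
qed auto

lemma abs_integrable_frac_int_kernel:
  fixes \<gamma> x :: real
  assumes "\<gamma> > 0"
  shows "(\<lambda>t. (x - t) powr (\<gamma> - 1)) absolutely_integrable_on {0..x}"
proof (cases "x \<ge> 0")
  case True
  \<comment> \<open>Take \<open>p = 1\<close>. The factor \<open>t powr 0\<close> is 1 except at
    \<open>t = 0\<close>, where it is 0; the spike set \<open>{0}\<close> absorbs this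
    point.\<close>
  have "((\<lambda>t. (x - t) powr (\<gamma> - 1)) has_integral Beta 1 \<gamma> * x powr (1 + \<gamma> - 1)) {0..x}"
    by (rule has_integral_spike_finite[OF _ _ has_integral_Beta_scaled[of 1 \<gamma> x], of "{0}"])
      (use assms True in auto)
  then show ?thesis
    by (intro nonnegative_absolutely_integrable_1) auto
qed simp

text \<open>A continuous function on a compact interval is bounded and measurable, so it can
  multiply an integrable singular kernel. This serves both
  \<open>(x - t) powr (\<gamma> - 1)\<close> and \<open>t powr (- \<beta>)\<close>.\<close>

lemma abs_integrable_mult_continuous:
  fixes k h :: "real \<Rightarrow> real"
  assumes "k absolutely_integrable_on {u..v}" "continuous_on {u..v} h"
  shows "(\<lambda>t. k t * h t) absolutely_integrable_on {u..v}"
proof -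
  have "(\<lambda>t. h t * k t) absolutely_integrable_on {u..v}"
  proof (rule absolutely_integrable_bounded_measurable_product_real)
    show "h \<in> borel_measurable (lebesgue_on {u..v})"
      by (intro continuous_imp_measurable_on_sets_lebesgue assms(2)) simp
    show "bounded (h ` {u..v})"
      by (intro compact_imp_bounded compact_continuous_image assms(2)) simp
  qed (use assms in auto)
  then show ?thesis by (simp add: mult.commute)
qed

lemma frac_int_integrable:
  fixes \<gamma> x :: real
  assumes "\<gamma> > 0" "continuous_on {0..x} h"
  shows "(\<lambda>t. (x - t) powr (\<gamma> - 1) * h t) integrable_on {0..x}"
  using abs_integrable_mult_continuous[OF abs_integrable_frac_int_kernel[OF assms(1)] assms(2)]
  by (auto simp: absolutely_integrable_on_def)

lemma frac_int_cong:
  assumes "\<And>t. t \<in> {0..x} \<Longrightarrow> h t = k t"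
  shows "frac_int \<gamma> h x = frac_int \<gamma> k x"
  unfolding frac_int_def using assms by (intro arg_cong2[of _ _ _ _ "(/)"] integral_cong) auto

lemma frac_int_diff:
  assumes "\<gamma> > 0" "continuous_on {0..x} h" "continuous_on {0..x} k"
  shows "frac_int \<gamma> (\<lambda>t. h t - k t) x = frac_int \<gamma> h x - frac_int \<gamma> k x"
  unfolding frac_int_def
  using integral_diff[OF frac_int_integrable[OF assms(1,2)] frac_int_integrable[OF assms(1,3)]]
  by (simp add: right_diff_distrib diff_divide_distrib)

lemma frac_int_cmult: "frac_int \<gamma> (\<lambda>t. c * h t) x = c * frac_int \<gamma> h x"
  by (simp add: frac_int_def mult.left_commute)

lemma frac_int_sum:
  assumes "\<gamma> > 0" "\<And>i. i \<in> I \<Longrightarrow> continuous_on {0..x} (h i)" "finite I"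
  shows "frac_int \<gamma> (\<lambda>t. \<Sum>i\<in>I. h i t) x = (\<Sum>i\<in>I. frac_int \<gamma> (h i) x)"
  unfolding frac_int_def
  using integral_sum[OF assms(3) frac_int_integrable[OF assms(1,2)]]
  by (simp add: sum_distrib_left sum_divide_distrib)

lemma frac_int_powr:
  assumes "\<gamma> > 0" "p > - 1" "x \<ge> 0"
  shows "frac_int \<gamma> (\<lambda>t. t powr p) x = Gamma (p + 1) / Gamma (p + \<gamma> + 1) * x powr (p + \<gamma>)"
  using integral_unique[OF has_integral_Beta_scaled[of "p + 1" \<gamma> x]] assms Gamma_real_nonzero[of \<gamma>]
  by (simp add: frac_int_def Beta_def add_ac)

lemma frac_int_power:
  assumes "\<gamma> > 0" "x \<ge> 0"
  shows "frac_int \<gamma> (\<lambda>t. t ^ n) x = fact n / Gamma (n + \<gamma> + 1) * x powr (n + \<gamma>)"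
proof -
  \<comment> \<open>For \<open>n = 0\<close> the integrands differ at \<open>t = 0\<close>, because
    \<open>0 ^ 0 = 1\<close> while \<open>0 powr 0 = 0\<close>.\<close>
  have "frac_int \<gamma> (\<lambda>t. t ^ n) x = frac_int \<gamma> (\<lambda>t. t powr n) x"
    unfolding frac_int_def
    by (intro arg_cong2[of _ _ _ _ "(/)"] integral_spike[of "{0}"]) (auto simp: powr_realpow)
  then show ?thesis
    using frac_int_powr[of \<gamma> n x] assms Gamma_fact[of n, where 'a=real] by (simp add: add_ac)
qed

lemma abs_frac_int_le:
  assumes "\<gamma> > 0" "x \<ge> 0" "continuous_on {0..x} h" "\<And>t. t \<in> {0..x} \<Longrightarrow> \<bar>h t\<bar> \<le> B"
  shows "\<bar>frac_int \<gamma> h x\<bar> \<le> B * x powr \<gamma> / Gamma (\<gamma> + 1)"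
proof -
  have G: "Gamma \<gamma> > 0" using assms by (simp add: Gamma_real_pos)
  have "\<bar>integral {0..x} (\<lambda>t. (x - t) powr (\<gamma> - 1) * h t)\<bar>
      \<le> integral {0..x} (\<lambda>t. (x - t) powr (\<gamma> - 1) * B)"
    unfolding real_norm_def[symmetric]
    by (rule integral_norm_bound_integral)
      (use assms in \<open>auto simp: abs_mult intro!: mult_left_mono frac_int_integrable\<close>)
  \<comment> \<open>The constant is written as \<open>B * t ^ 0\<close> so that the monomial formula
    evaluates its fractional integral.\<close>
  then have "\<bar>frac_int \<gamma> h x\<bar> \<le> frac_int \<gamma> (\<lambda>t. B * t ^ 0) x"
    unfolding frac_int_def using G by (auto simp: divide_simps)
  also have "\<dots> = B * frac_int \<gamma> (\<lambda>t. t ^ 0) x"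
    by (rule frac_int_cmult)
  finally show ?thesis
    using frac_int_power[of \<gamma> x 0] assms by simp
qed

section \<open>Polynomial approximation: continuity, complementary orders, injectivity\<close>

lemma polynomial_approx:
  fixes h :: "real \<Rightarrow> real"
  assumes "continuous_on {u..v} h" "e > 0"
  obtains c n where "\<And>t. t \<in> {u..v} \<Longrightarrow> \<bar>h t - (\<Sum>i\<le>n. c i * t ^ i)\<bar> < e"
proof -
  obtain g where "real_polynomial_function g" "\<And>t. t \<in> {u..v} \<Longrightarrow> \<bar>h t - g t\<bar> < e"
    using Stone_Weierstrass_real_polynomial_function[OF compact_Icc assms] by metis
  then show thesis
    using that unfolding real_polynomial_function_iff_sum by metis
qed

lemma frac_int_polynomial:
  fixes \<gamma> x :: real and c :: "nat \<Rightarrow> real"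
  assumes "\<gamma> > 0" "x \<ge> 0"
  shows "frac_int \<gamma> (\<lambda>t. \<Sum>i\<le>n. c i * t ^ i) x
    = (\<Sum>i\<le>n. c i * (fact i / Gamma (i + \<gamma> + 1)) * x powr (i + \<gamma>))"
  using assms
  by (subst frac_int_sum) (auto intro!: continuous_intros sum.cong simp: frac_int_cmult frac_int_power add_ac)

text \<open>Polynomials are mapped to explicit combinations of the powers
  \<open>x powr (i + \<gamma>)\<close>, which are continuous up to 0 as \<open>\<gamma> > 0\<close>.
  By \<open>abs_frac_int_le\<close>, uniform approximation of \<open>h\<close> by polynomials
  carries over to the images, and uniform limits preserve continuity.\<close>

lemma continuous_on_frac_int:
  assumes "\<gamma> > 0" "continuous_on {0..a} h"
  shows "continuous_on {0..a} (frac_int \<gamma> h)"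
proof -
  define K where "K = a powr \<gamma> / Gamma (\<gamma> + 1)"
  have "\<exists>c n. \<forall>t\<in>{0..a}. \<bar>h t - (\<Sum>i\<le>n. c i * t ^ i)\<bar> \<le> 1 / Suc k" for k
    using polynomial_approx[OF assms(2), of "1 / Suc k"] by (metis less_imp_le of_nat_0_less_iff zero_less_Suc zero_less_divide_1_iff)
  then obtain c n where cn: "\<And>k t. t \<in> {0..a} \<Longrightarrow> \<bar>h t - (\<Sum>i\<le>n k. c k i * t ^ i)\<bar> \<le> 1 / Suc k"
    by metis
  define P where "P = (\<lambda>k. frac_int \<gamma> (\<lambda>t. \<Sum>i\<le>n k. c k i * t ^ i))"
  have P: "P k x = (\<Sum>i\<le>n k. c k i * (fact i / Gamma (i + \<gamma> + 1)) * x powr (i + \<gamma>))"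
    if "x \<in> {0..a}" for k x
    unfolding P_def using that assms by (intro frac_int_polynomial) auto
  have "continuous_on {0..a} (P k)" for k
    by (subst continuous_on_cong[OF refl P], assumption)
      (use assms in \<open>auto intro!: continuous_on_sum continuous_on_mult_left continuous_on_powr_const
        simp del: times_divide_eq_right times_divide_eq_left\<close>)
  then have ev: "\<forall>\<^sub>F k in sequentially. continuous_on {0..a} (P k)" by simp
  have est: "\<bar>frac_int \<gamma> h x - P k x\<bar> \<le> (1 / Suc k) * K" if x: "x \<in> {0..a}" for k x
  proof -
    have hx: "continuous_on {0..x} h"
      using assms(2) x by (auto intro: continuous_on_subset)
    have "\<bar>frac_int \<gamma> h x - P k x\<bar> \<le> (1 / Suc k) * x powr \<gamma> / Gamma (\<gamma> + 1)"
      unfolding P_def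
      by (subst frac_int_diff[symmetric], (use assms x hx in \<open>auto intro!: continuous_intros\<close>)[3],
          rule abs_frac_int_le)
        (use assms x cn hx in \<open>auto intro!: continuous_intros simp del: of_nat_Suc\<close>)
    also have "\<dots> \<le> (1 / Suc k) * K"
      unfolding K_def using assms x
      by (auto simp: divide_simps Gamma_real_pos intro!: powr_mono2)
    finally show ?thesis .
  qed
  have lim: "(\<lambda>k. (1 / Suc k) * K) \<longlonglongrightarrow> 0"
    using tendsto_mult_left_zero[OF LIMSEQ_Suc[OF lim_1_over_n], of K] by simp
  have "uniform_limit {0..a} P (frac_int \<gamma> h) sequentially"
  proof (rule uniform_limitI)
    fix e :: real assume "e > 0"
    then have "\<forall>\<^sub>F k in sequentially. (1 / Suc k) * K < e"
      using lim by (rule order_tendstoD(2)[rotated])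
    then show "\<forall>\<^sub>F k in sequentially. \<forall>x\<in>{0..a}. dist (P k x) (frac_int \<gamma> h x) < e"
    proof eventually_elim
      case (elim k)
      then show ?case
        using le_less_trans[OF est] by (simp add: dist_real_def abs_minus_commute)
    qed
  qed
  then show ?thesis
    by (rule uniform_limit_theorem[OF ev]) simp
qed

text \<open>Instead of applying Fubini on the triangle, note that both sides are continuous in \<open>h\<close> for the
  supremum norm, so it suffices to compare them on monomials, where they are Beta integrals.\<close>

lemma frac_int_complementary:
  assumes "0 < \<gamma>" "\<gamma> < 1" "x \<ge> 0" "continuous_on {0..x} h"
  shows "frac_int (1 - \<gamma>) (frac_int \<gamma> h) x = integral {0..x} h"
proof -
  have mono: "frac_int (1 - \<gamma>) (frac_int \<gamma> (\<lambda>t. \<Sum>i\<le>n. c i * t ^ i)) x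
      = integral {0..x} (\<lambda>t. \<Sum>i\<le>n. c i * t ^ i)" for c and n :: nat
  proof -
    have "frac_int (1 - \<gamma>) (frac_int \<gamma> (\<lambda>t. \<Sum>i\<le>n. c i * t ^ i)) x
      = frac_int (1 - \<gamma>) (\<lambda>t. \<Sum>i\<le>n. c i * (fact i / Gamma (i + \<gamma> + 1)) * t powr (i + \<gamma>)) x"
      using assms by (intro frac_int_cong frac_int_polynomial) auto
    also have "\<dots> = (\<Sum>i\<le>n. c i * (fact i / Gamma (i + \<gamma> + 1))
        * frac_int (1 - \<gamma>) (\<lambda>t. t powr (i + \<gamma>)) x)"
      using assms
      by (subst frac_int_sum)
        (auto intro!: continuous_on_mult_left continuous_on_powr_const
          simp: frac_int_cmult simp del: times_divide_eq_right times_divide_eq_left)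
    also have "\<dots> = (\<Sum>i\<le>n. c i * (x ^ Suc i / Suc i))"
    proof (rule sum.cong[OF refl])
      fix i :: nat
      \<comment> \<open>The orders add up to 1, so the two Gamma quotients telescope to
        \<open>fact i / fact (Suc i)\<close>, the coefficient of an ordinary primitive.\<close>
      have G: "Gamma (i + \<gamma> + 1) > 0" using assms by (simp add: Gamma_real_pos)
      have "Gamma (real i + 2) = fact (Suc i)"
        using Gamma_fact[of "Suc i", where 'a=real] by (simp add: add_ac)
      moreover have "x powr (i + 1) = x ^ Suc i"
        using powr_realpow'[of x "Suc i"] assms by (simp add: add_ac)
      ultimately have "frac_int (1 - \<gamma>) (\<lambda>t. t powr (i + \<gamma>)) x
          = Gamma (i + \<gamma> + 1) / fact (Suc i) * x ^ Suc i"
        using frac_int_powr[of "1 - \<gamma>" "i + \<gamma>" x] assms by (simp add: add_ac)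
      then show "c i * (fact i / Gamma (i + \<gamma> + 1)) * frac_int (1 - \<gamma>) (\<lambda>t. t powr (i + \<gamma>)) x
          = c i * (x ^ Suc i / Suc i)"
        using G by (simp add: divide_simps mult_ac)
    qed
    also have "\<dots> = integral {0..x} (\<lambda>t. \<Sum>i\<le>n. c i * t ^ i)"
    proof -
      have "((\<lambda>t. t ^ i) has_integral x ^ Suc i / Suc i) {0..x}" for i
      proof -
        have "((\<lambda>t. t ^ i) has_integral x ^ Suc i / Suc i - 0 ^ Suc i / Suc i) {0..x}"
          by (rule fundamental_theorem_of_calculus[OF assms(3)],
              unfold has_real_derivative_iff_has_vector_derivative[symmetric], rule DERIV_cong)
            (auto intro!: derivative_eq_intros simp del: power_Suc of_nat_Suc)
        then show ?thesis by simp
      qed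
      then show ?thesis
        by (intro integral_unique[symmetric] has_integral_sum has_integral_mult_right) auto
    qed
    finally show ?thesis .
  qed
  \<comment> \<open>The first summand is the sup bound for order \<open>\<gamma>\<close> followed by
    the one for order \<open>1 - \<gamma>\<close>; the second is the interval length, from the
    ordinary integral.\<close>
  define K where "K = x powr \<gamma> / Gamma (\<gamma> + 1) * (x powr (1 - \<gamma>) / Gamma (2 - \<gamma>)) + x"
  have K: "K \<ge> 0" using assms by (simp add: K_def)
  have *: "\<bar>frac_int (1 - \<gamma>) (frac_int \<gamma> h) x - integral {0..x} h\<bar> \<le> e * K" if e: "e > 0" for e
  proof -
    obtain c n where cn: "\<And>t. t \<in> {0..x} \<Longrightarrow> \<bar>h t - (\<Sum>i\<le>n. c i * t ^ i)\<bar> < e"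
      using polynomial_approx[OF assms(4) e] by metis
    define p where "p = (\<lambda>t. \<Sum>i\<le>n. c i * t ^ i)"
    have p: "continuous_on S p" for S unfolding p_def by (intro continuous_intros)
    have d: "\<bar>frac_int \<gamma> h s - frac_int \<gamma> p s\<bar> \<le> e * x powr \<gamma> / Gamma (\<gamma> + 1)" if s: "s \<in> {0..x}" for s
    proof -
      have hs: "continuous_on {0..s} h" using assms(4) s by (auto intro: continuous_on_subset)
      have "\<bar>frac_int \<gamma> h s - frac_int \<gamma> p s\<bar> \<le> e * s powr \<gamma> / Gamma (\<gamma> + 1)"
      proof (subst frac_int_diff[symmetric])
        show "\<bar>frac_int \<gamma> (\<lambda>t. h t - p t) s\<bar> \<le> e * s powr \<gamma> / Gamma (\<gamma> + 1)"
        proof (rule abs_frac_int_le)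
          show "\<bar>h t - p t\<bar> \<le> e" if "t \<in> {0..s}" for t
            using cn[of t] that s unfolding p_def by auto
        qed (use assms s hs p in \<open>auto intro: continuous_on_diff\<close>)
      qed (use assms hs p in auto)
      also have "\<dots> \<le> e * x powr \<gamma> / Gamma (\<gamma> + 1)"
        using assms s e by (auto simp: divide_simps Gamma_real_pos intro!: powr_mono2)
      finally show ?thesis .
    qed
    have "\<bar>frac_int (1 - \<gamma>) (frac_int \<gamma> h) x - frac_int (1 - \<gamma>) (frac_int \<gamma> p) x\<bar>
       \<le> (e * x powr \<gamma> / Gamma (\<gamma> + 1)) * x powr (1 - \<gamma>) / Gamma ((1 - \<gamma>) + 1)"
    proof -
      have "continuous_on {0..x} (frac_int \<gamma> h)" "continuous_on {0..x} (frac_int \<gamma> p)"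
        using assms p by (auto intro: continuous_on_frac_int)
      then show ?thesis
        using abs_frac_int_le[of "1 - \<gamma>" x "\<lambda>s. frac_int \<gamma> h s - frac_int \<gamma> p s"
            "e * x powr \<gamma> / Gamma (\<gamma> + 1)"] assms d
        by (simp add: frac_int_diff continuous_on_diff)
    qed
    moreover have "\<bar>integral {0..x} h - integral {0..x} p\<bar> \<le> e * x"
    proof -
      have "\<bar>integral {0..x} h - integral {0..x} p\<bar> = norm (integral {0..x} (\<lambda>t. h t - p t))"
        using assms p by (subst integral_diff) (auto intro: integrable_continuous_real)
      also have "\<dots> \<le> e * (x - 0)"
      proof (rule integral_bound)
        show "norm (h t - p t) \<le> e" if "t \<in> {0..x}" for t
          using cn[OF that] unfolding p_def by simp
      qed (use assms p in \<open>auto intro: continuous_on_diff\<close>)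
      finally show ?thesis by simp
    qed
    moreover have "frac_int (1 - \<gamma>) (frac_int \<gamma> p) x = integral {0..x} p"
      unfolding p_def by (rule mono)
    moreover have "(e * x powr \<gamma> / Gamma (\<gamma> + 1)) * x powr (1 - \<gamma>) / Gamma ((1 - \<gamma>) + 1) + e * x = e * K"
      unfolding K_def by (simp add: distrib_left)
    ultimately show ?thesis by linarith
  qed
  have "\<bar>frac_int (1 - \<gamma>) (frac_int \<gamma> h) x - integral {0..x} h\<bar> \<le> 0 + e" if e: "e > 0" for e
  proof -
    \<comment> \<open>\<open>K\<close> is 0 when \<open>x = 0\<close>, hence the division by
      \<open>K + 1\<close>.\<close>
    have "e / (K + 1) * K \<le> e"
      using K e by (simp add: field_simps)
    then show ?thesis
      using *[of "e / (K + 1)"] K e by simp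
  qed
  then have "\<bar>frac_int (1 - \<gamma>) (frac_int \<gamma> h) x - integral {0..x} h\<bar> \<le> 0"
    by (rule field_le_epsilon)
  then show ?thesis by simp
qed

text \<open>Applying the integral of order \<open>1 - \<gamma>\<close> shows that the primitive of
  \<open>h\<close> vanishes on the whole interval, hence so does its derivative
  \<open>h\<close>.\<close>

lemma frac_int_eq_0_imp:
  assumes "0 < \<gamma>" "\<gamma> < 1" "continuous_on {0..a} h" "\<And>x. x \<in> {0..a} \<Longrightarrow> frac_int \<gamma> h x = 0"
    and x: "x \<in> {0..a}" and "a > 0"
  shows "h x = 0"
proof -
  have "integral {0..y} h = 0" if y: "y \<in> {0..a}" for y
  proof -
    have "integral {0..y} h = frac_int (1 - \<gamma>) (frac_int \<gamma> h) y"
      using assms y by (intro frac_int_complementary[symmetric]) (auto intro: continuous_on_subset)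
    also have "\<dots> = frac_int (1 - \<gamma>) (\<lambda>_. 0) y"
      using assms y by (intro frac_int_cong) auto
    finally show ?thesis by (simp add: frac_int_def)
  qed
  then have "((\<lambda>_. 0) has_vector_derivative h x) (at x within {0..a})"
    using integral_has_vector_derivative[OF assms(3) x] x
    by (metis (mono_tags, lifting) has_vector_derivative_transform)
  \<comment> \<open>Derivatives within \<open>{0..a}\<close> are unique because the interval is
    nondegenerate; this includes the end points.\<close>
  then show ?thesis
    using x \<open>a > 0\<close> vector_derivative_within_cbox[of 0 a x "\<lambda>_. 0::real"] 
    by (metis box_real(2) has_vector_derivative_const)
qed

subsection \<open>Fixed points in weighted supremum norms\<close>

text \<open>Dividing by \<open>\<phi>\<close> and extending constantly outside \<open>{0..a}\<close>
  by \<open>clamp\<close> moves continuous functions into the complete space of bounded continuous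
  functions on the line. There \<open>contr\<close> becomes a \<open>q\<close>-contraction for the
  sup distance, and Banach's theorem applies. Quantifying over every majorant \<open>B\<close>
  avoids defining a weighted norm.\<close>

lemma weighted_contraction:
  fixes P :: "(real \<Rightarrow> real) \<Rightarrow> real \<Rightarrow> real" and \<phi> :: "real \<Rightarrow> real"
  assumes a: "a \<ge> 0" and q: "0 \<le> q" "q < 1"
    and \<phi>: "continuous_on {0..a} \<phi>" "\<And>x. x \<in> {0..a} \<Longrightarrow> \<phi> x > 0"
    and P: "\<And>v. continuous_on {0..a} v \<Longrightarrow> continuous_on {0..a} (P v)"
    and contr: "\<And>v w B x. continuous_on {0..a} v \<Longrightarrow> continuous_on {0..a} w \<Longrightarrow>
      (\<And>t. t \<in> {0..a} \<Longrightarrow> \<bar>v t - w t\<bar> \<le> B * \<phi> t) \<Longrightarrow> x \<in> {0..a} \<Longrightarrow>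
      \<bar>P v x - P w x\<bar> \<le> q * B * \<phi> x"
  obtains v where "continuous_on {0..a} v" "\<And>x. x \<in> {0..a} \<Longrightarrow> P v x = v x"
    "\<And>w. continuous_on {0..a} w \<Longrightarrow> (\<And>x. x \<in> {0..a} \<Longrightarrow> P w x = w x) \<Longrightarrow>
      (\<And>x. x \<in> {0..a} \<Longrightarrow> w x = v x)"
proof -
  have clamp: "clamp 0 a x \<in> {0..a}" for x
    using clamp_in_interval[of 0 a x] a by (simp add: cbox_interval)
  have clamp_id: "clamp 0 a x = x" if "x \<in> {0..a}" for x
    using clamp_cancel_cbox[of x 0 a] that by (simp add: cbox_interval)
  have ex: "\<exists>g :: real \<Rightarrow>\<^sub>C real. \<forall>x. g x = v (clamp 0 a x) / \<phi> (clamp 0 a x)"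
    if v: "continuous_on {0..a} v" for v
  proof -
    have "\<phi> x \<noteq> 0" if "x \<in> {0..a}" for x
      using \<phi>(2)[OF that] by simp
    then have "continuous_on (cbox 0 a) (\<lambda>x. v x / \<phi> x)"
      unfolding box_real using v \<phi>(1) by (intro continuous_on_divide) blast+
    then obtain g :: "real \<Rightarrow>\<^sub>C real" where "\<And>x. g x = v (clamp 0 a x) / \<phi> (clamp 0 a x)"
      by (rule continuous_on_cbox_bcontfunE) (rule that)
    then show ?thesis by blast
  qed
  \<comment> \<open>\<open>N\<close> normalises and extends; \<open>U\<close> below undoes the
    normalisation. \<open>U (N v)\<close> agrees with \<open>v\<close> on \<open>{0..a}\<close>
    only.\<close>
  define N where "N = (\<lambda>v. SOME g :: real \<Rightarrow>\<^sub>C real.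
      \<forall>x. g x = v (clamp 0 a x) / \<phi> (clamp 0 a x))"
  have N: "apply_bcontfun (N v) x = v (clamp 0 a x) / \<phi> (clamp 0 a x)"
    if "continuous_on {0..a} v" for v x
    using someI_ex[OF ex[OF that]] unfolding N_def by blast
  define U where "U = (\<lambda>(g :: real \<Rightarrow>\<^sub>C real) x. \<phi> x * g x)"
  have U: "continuous_on {0..a} (U g)" for g
    unfolding U_def by (intro continuous_intros \<phi> continuous_on_apply_bcontfun)
  have UN: "U (N v) x = v x" if "continuous_on {0..a} v" "x \<in> {0..a}" for v x
    using that \<phi>(2)[of x] by (simp add: U_def N clamp_id)
  define F where "F = (\<lambda>g. N (P (U g)))"
  have "dist (F g) (F h) \<le> q * dist g h" for g h
  proof (rule dist_bound)
    fix x
    define y where "y = clamp 0 a x"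
    have y: "y \<in> {0..a}" using clamp y_def by simp
    \<comment> \<open>The sup distance of \<open>g\<close> and \<open>h\<close> is an admissible
      majorant \<open>B\<close> for their images under \<open>U\<close>.\<close>
    have "\<bar>U g t - U h t\<bar> \<le> dist g h * \<phi> t" if "t \<in> {0..a}" for t
      using dist_bounded[of g t h] \<phi>(2)[OF that]
      by (simp add: U_def dist_real_def abs_mult mult.commute flip: right_diff_distrib)
    from contr[OF U U this y] have "\<bar>P (U g) y - P (U h) y\<bar> \<le> q * dist g h * \<phi> y"
      by simp
    then show "dist (F g x) (F h x) \<le> q * dist g h"
      using \<phi>(2)[OF y]
      by (simp add: F_def N[OF P[OF U]] dist_real_def pos_divide_le_eq flip: y_def diff_divide_distrib)
  qed
  then have "\<exists>!g. F g = g"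
    using q by (intro banach_fix_type[of q]) auto
  then obtain g where g: "F g = g" "\<And>h. F h = h \<Longrightarrow> h = g" by blast
  \<comment> \<open>A priori \<open>P v\<close> could depend on values of \<open>v\<close> outside
    \<open>{0..a}\<close>; the case \<open>B = 0\<close> of \<open>contr\<close> excludes this. It
    is what allows replacing \<open>U (N w)\<close> by \<open>w\<close> under
    \<open>P\<close>.\<close>
  have ext: "P v x = P w x" if "continuous_on {0..a} v" "continuous_on {0..a} w"
    "\<And>t. t \<in> {0..a} \<Longrightarrow> v t = w t" "x \<in> {0..a}" for v w x
    using contr[OF that(1,2), of 0 x] that by simp
  show thesis
  proof (rule that[of "U g"])
    show "P (U g) x = U g x" if "x \<in> {0..a}" for x
    proof -
      have "U (N (P (U g))) x = P (U g) x" by (rule UN[OF P[OF U] that])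
      moreover have "N (P (U g)) = g" using g(1) by (simp only: F_def)
      ultimately show ?thesis by simp
    qed
    fix w x assume w: "continuous_on {0..a} w" "\<And>x. x \<in> {0..a} \<Longrightarrow> P w x = w x"
      and x: "x \<in> {0..a}"
    have PU: "P (U (N w)) y = w y" if y: "y \<in> {0..a}" for y
    proof -
      have "P (U (N w)) y = P w y"
        using U w(1) UN[OF w(1)] y by (rule ext)
      also have "\<dots> = w y" by (rule w(2)[OF y])
      finally show ?thesis .
    qed
    then have "F (N w) = N w"
      unfolding F_def by (intro bcontfun_eqI) (simp only: N[OF P[OF U]] N[OF w(1)] PU[OF clamp])
    then have "N w = g" by (rule g(2))
    then show "w x = U g x" using UN[OF w(1) x] by simp
  qed (rule U)
qed

subsection \<open>The Volterra equation\<close>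

lemma powr_weight_continuous:
  fixes \<beta> a c :: real
  assumes "\<beta> < 1"
  shows "continuous_on {0..a} (\<lambda>t. exp (c * t powr (1 - \<beta>)))"
  by (rule continuous_on_exp[OF continuous_on_mult_left[OF continuous_on_powr_const]])
    (use assms in simp)

text \<open>The weight is chosen so that its derivative reproduces the singular factor \<open>t powr (- \<beta>)\<close>.\<close>

lemma has_integral_powr_weight:
  fixes \<beta> c x :: real
  assumes "\<beta> < 1" "c > 0" "x \<ge> 0"
  shows "((\<lambda>t. t powr (- \<beta>) * exp (c * t powr (1 - \<beta>))) has_integral
    (exp (c * x powr (1 - \<beta>)) - 1) / (c * (1 - \<beta>))) {0..x}"
proof -
  have "((\<lambda>t. t powr (- \<beta>) * exp (c * t powr (1 - \<beta>))) has_integral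
      exp (c * x powr (1 - \<beta>)) / (c * (1 - \<beta>)) - exp (c * 0 powr (1 - \<beta>)) / (c * (1 - \<beta>))) {0..x}"
  \<comment> \<open>The antiderivative is continuous on the closed interval but need not be
    differentiable at 0, so derivatives are taken in the interior only.\<close>
  proof (rule fundamental_theorem_of_calculus_interior[OF assms(3)])
    show "continuous_on {0..x} (\<lambda>t. exp (c * t powr (1 - \<beta>)) / (c * (1 - \<beta>)))"
      using assms by (intro continuous_on_divide powr_weight_continuous) auto
    fix t assume "t \<in> {0<..<x}"
    then have "((\<lambda>t. t powr (1 - \<beta>)) has_real_derivative (1 - \<beta>) * t powr (- \<beta>)) (at t)"
      using has_real_derivative_powr[of t "1 - \<beta>"] by simp
    from DERIV_cdivide[OF DERIV_fun_exp[OF DERIV_cmult[OF this]], of c "c * (1 - \<beta>)"]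
    show "((\<lambda>t. exp (c * t powr (1 - \<beta>)) / (c * (1 - \<beta>))) has_vector_derivative
        t powr (- \<beta>) * exp (c * t powr (1 - \<beta>))) (at t)"
      unfolding has_real_derivative_iff_has_vector_derivative[symmetric]
      using assms by (simp add: mult_ac)
  qed
  then show ?thesis using assms by (simp add: diff_divide_distrib)
qed

lemma powr_abs_integrable:
  fixes \<beta> x :: real
  assumes "\<beta> < 1"
  shows "(\<lambda>t. t powr (- \<beta>)) absolutely_integrable_on {0..x}"
proof (cases "x \<ge> 0")
  case True
  then show ?thesis
    using integrable_on_powr_from_0[of "- \<beta>" x] assms
    by (intro nonnegative_absolutely_integrable_1) auto
qed simp

lemma powr_mult_integrable:
  fixes \<beta> x :: real and k :: "real \<Rightarrow> real"
  assumes "\<beta> < 1" "continuous_on {0..x} k"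
  shows "(\<lambda>t. t powr (- \<beta>) * k t) integrable_on {0..x}"
  using abs_integrable_mult_continuous[OF powr_abs_integrable[OF assms(1)] assms(2)]
  by (auto simp: absolutely_integrable_on_def)

section \<open>The Picard operator and its fixed point\<close>

definition picard_op ::
    "real \<Rightarrow> real \<Rightarrow> (real \<Rightarrow> real \<Rightarrow> real \<Rightarrow> real) \<Rightarrow> (real \<Rightarrow> real) \<Rightarrow> real \<Rightarrow> real" where
  "picard_op \<beta> b g v x = b + integral {0..x} (\<lambda>t. t powr (- \<beta>) * g t (frac_int \<beta> v t) (v t))"

lemma continuous_on_picard_integrand:
  assumes "0 < \<beta>" "continuous_on {0..a} v"
    and g: "continuous_on ({0..a} \<times> UNIV \<times> UNIV) (\<lambda>(x, t1, t2). g x t1 t2)"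
  shows "continuous_on {0..a} (\<lambda>t. g t (frac_int \<beta> v t) (v t))"
proof -
  have "continuous_on {0..a} (\<lambda>t. (t, frac_int \<beta> v t, v t))"
    using assms by (intro continuous_on_Pair continuous_on_id continuous_on_frac_int)
  from continuous_on_compose2[OF g this] show ?thesis by auto
qed

lemma continuous_on_picard_op:
  assumes "0 < \<beta>" "\<beta> < 1" "continuous_on {0..a} v"
    and "continuous_on ({0..a} \<times> UNIV \<times> UNIV) (\<lambda>(x, t1, t2). g x t1 t2)"
  shows "continuous_on {0..a} (picard_op \<beta> b g v)"
  unfolding picard_op_def
  by (rule continuous_on_add[OF continuous_on_const indefinite_integral_continuous_1[OF
        powr_mult_integrable[OF assms(2) continuous_on_picard_integrand[OF assms(1,3,4)]]]])

text \<open>Since the weight is nondecreasing, the bound on \<open>v - w\<close> passes through the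
  fractional integral at the cost of \<open>a powr \<beta> / Gamma (\<beta> + 1)\<close>. The
  Lipschitz condition then gives the constant \<open>D\<close>, and integrating
  \<open>t powr (- \<beta>)\<close> times the weight returns the weight divided by
  \<open>c * (1 - \<beta>)\<close>.\<close>

lemma picard_op_contraction:
  fixes \<beta> a c K :: real and g :: "real \<Rightarrow> real \<Rightarrow> real \<Rightarrow> real"
  assumes "0 < \<beta>" "\<beta> < 1" "c > 0" "K \<ge> 0"
    and g: "continuous_on ({0..a} \<times> UNIV \<times> UNIV) (\<lambda>(x, t1, t2). g x t1 t2)"
    and lip: "\<And>x s t s' t'. x \<in> {0..a} \<Longrightarrow> \<bar>g x s t - g x s' t'\<bar> \<le> K * (\<bar>s - s'\<bar> + \<bar>t - t'\<bar>)"
    and v: "continuous_on {0..a} v" and w: "continuous_on {0..a} w"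
    and vw: "\<And>t. t \<in> {0..a} \<Longrightarrow> \<bar>v t - w t\<bar> \<le> B * exp (c * t powr (1 - \<beta>))"
    and x: "x \<in> {0..a}"
  shows "\<bar>picard_op \<beta> b g v x - picard_op \<beta> b g w x\<bar>
    \<le> K * (a powr \<beta> / Gamma (\<beta> + 1) + 1) / (c * (1 - \<beta>)) * B * exp (c * x powr (1 - \<beta>))"
proof -
  define \<phi> where "\<phi> = (\<lambda>t. exp (c * t powr (1 - \<beta>)))"
  define D where "D = K * (a powr \<beta> / Gamma (\<beta> + 1) + 1)"
  have D: "D \<ge> 0" using assms by (auto simp: D_def)
  have vw\<phi>: "\<And>t. t \<in> {0..a} \<Longrightarrow> \<bar>v t - w t\<bar> \<le> B * \<phi> t"
    using vw by (simp add: \<phi>_def)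
  \<comment> \<open>\<open>B\<close> is not assumed nonnegative; its sign follows from the bound at
    the single point \<open>x\<close>.\<close>
  have "0 \<le> B * \<phi> x" using vw\<phi>[OF x] by linarith
  then have B: "B \<ge> 0" by (simp add: \<phi>_def zero_le_mult_iff not_le)
  let ?G = "\<lambda>v t. g t (frac_int \<beta> v t) (v t)"
  have int: "(\<lambda>t. t powr (- \<beta>) * ?G v t) integrable_on {0..x}"
      if "continuous_on {0..a} v" for v
    using continuous_on_subset[OF continuous_on_picard_integrand[OF assms(1) that g]] x assms(2)
    by (intro powr_mult_integrable) auto
  have J: "\<bar>frac_int \<beta> v t - frac_int \<beta> w t\<bar> \<le> a powr \<beta> / Gamma (\<beta> + 1) * (B * \<phi> t)"
    if t: "t \<in> {0..a}" for t
  proof -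
    have cont: "continuous_on {0..t} v" "continuous_on {0..t} w"
      using v w t by (auto intro: continuous_on_subset)
    have bd: "\<bar>v s - w s\<bar> \<le> B * \<phi> t" if s: "s \<in> {0..t}" for s
    proof -
      have "\<phi> s \<le> \<phi> t"
        using s t assms by (auto simp: \<phi>_def intro!: powr_mono2)
      then show ?thesis
        using vw\<phi>[of s] s t B mult_left_mono[of "\<phi> s" "\<phi> t" B] by force
    qed
    have "\<bar>frac_int \<beta> v t - frac_int \<beta> w t\<bar> \<le> (B * \<phi> t) * t powr \<beta> / Gamma (\<beta> + 1)"
      unfolding frac_int_diff[OF assms(1) cont, symmetric]
      using t cont bd assms by (intro abs_frac_int_le) (auto intro: continuous_intros)
    also have "\<dots> \<le> (B * \<phi> t) * a powr \<beta> / Gamma (\<beta> + 1)"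
      using t assms B by (intro divide_right_mono mult_left_mono powr_mono2) (auto simp: \<phi>_def)
    finally show ?thesis by (simp add: mult_ac)
  qed
  have bound: "\<bar>?G v t - ?G w t\<bar> \<le> D * B * \<phi> t" if t: "t \<in> {0..a}" for t
  proof -
    have "\<bar>?G v t - ?G w t\<bar> \<le> K * (\<bar>frac_int \<beta> v t - frac_int \<beta> w t\<bar> + \<bar>v t - w t\<bar>)"
      by (rule lip[OF t])
    also have "\<dots> \<le> K * (a powr \<beta> / Gamma (\<beta> + 1) * (B * \<phi> t) + B * \<phi> t)"
      using J[OF t] vw\<phi>[OF t] assms by (intro mult_left_mono add_mono) auto
    finally show ?thesis by (simp add: D_def algebra_simps)
  qed
  have hi: "((\<lambda>t. D * B * (t powr (- \<beta>) * \<phi> t)) has_integral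
      D * B * ((\<phi> x - 1) / (c * (1 - \<beta>)))) {0..x}"
    using has_integral_mult_right[OF has_integral_powr_weight] assms x by (simp add: \<phi>_def)
  have "\<bar>picard_op \<beta> b g v x - picard_op \<beta> b g w x\<bar>
      = norm (integral {0..x} (\<lambda>t. t powr (- \<beta>) * ?G v t - t powr (- \<beta>) * ?G w t))"
    unfolding picard_op_def using integral_diff[OF int[OF v] int[OF w]] by simp
  also have "\<dots> \<le> integral {0..x} (\<lambda>t. D * B * (t powr (- \<beta>) * \<phi> t))"
  proof (rule integral_norm_bound_integral)
    show "(\<lambda>t. t powr (- \<beta>) * ?G v t - t powr (- \<beta>) * ?G w t) integrable_on {0..x}"
      by (intro integrable_diff int v w)
    show "(\<lambda>t. D * B * (t powr (- \<beta>) * \<phi> t)) integrable_on {0..x}"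
      using hi by (rule has_integral_integrable)
    fix t assume t: "t \<in> {0..x}"
    then have "t powr (- \<beta>) * \<bar>?G v t - ?G w t\<bar> \<le> t powr (- \<beta>) * (D * B * \<phi> t)"
      using x by (intro mult_left_mono bound) auto
    then show "norm (t powr (- \<beta>) * ?G v t - t powr (- \<beta>) * ?G w t) \<le> D * B * (t powr (- \<beta>) * \<phi> t)"
      by (simp add: abs_mult mult_ac flip: right_diff_distrib)
  qed
  also have "\<dots> = D * B * ((\<phi> x - 1) / (c * (1 - \<beta>)))"
    using hi by (rule integral_unique)
  \<comment> \<open>Dropping the \<open>- 1\<close> leaves a multiple of the weight itself.\<close>
  also have "\<dots> \<le> D * B * (\<phi> x / (c * (1 - \<beta>)))"
    using D B assms by (intro mult_left_mono divide_right_mono) auto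
  also have "\<dots> = D / (c * (1 - \<beta>)) * B * \<phi> x" by simp
  finally show ?thesis unfolding D_def \<phi>_def .
qed

lemma picard_op_unique_fixed_point:
  fixes \<beta> a K :: real and g :: "real \<Rightarrow> real \<Rightarrow> real \<Rightarrow> real"
  assumes "0 < \<beta>" "\<beta> < 1" "a \<ge> 0" "K \<ge> 0"
    and g: "continuous_on ({0..a} \<times> UNIV \<times> UNIV) (\<lambda>(x, t1, t2). g x t1 t2)"
    and lip: "\<And>x s t s' t'. x \<in> {0..a} \<Longrightarrow> \<bar>g x s t - g x s' t'\<bar> \<le> K * (\<bar>s - s'\<bar> + \<bar>t - t'\<bar>)"
  obtains v where "continuous_on {0..a} v" "\<And>x. x \<in> {0..a} \<Longrightarrow> picard_op \<beta> b g v x = v x"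
    "\<And>w. continuous_on {0..a} w \<Longrightarrow> (\<And>x. x \<in> {0..a} \<Longrightarrow> picard_op \<beta> b g w x = w x) \<Longrightarrow>
      (\<And>x. x \<in> {0..a} \<Longrightarrow> w x = v x)"
proof -
  define D where "D = K * (a powr \<beta> / Gamma (\<beta> + 1) + 1)"
  \<comment> \<open>With this choice the contraction factor is \<open>D / (2 * D + 1)\<close>,
    whatever the sizes of \<open>K\<close> and \<open>a\<close>; the summand 1 keeps
    \<open>c\<close> positive when \<open>D = 0\<close>.\<close>
  define c where "c = (2 * D + 1) / (1 - \<beta>)"
  have D: "D \<ge> 0" using assms by (auto simp: D_def)
  have c: "c > 0" using D assms by (simp add: c_def)
  have c': "c * (1 - \<beta>) = 2 * D + 1" using assms by (simp add: c_def)
  have q: "0 \<le> D / (c * (1 - \<beta>))" "D / (c * (1 - \<beta>)) < 1"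
    unfolding c' using D by (auto simp: field_simps)
  have \<phi>: "exp (c * x powr (1 - \<beta>)) > 0" for x by simp
  have contr: "\<bar>picard_op \<beta> b g v x - picard_op \<beta> b g w x\<bar>
      \<le> D / (c * (1 - \<beta>)) * B * exp (c * x powr (1 - \<beta>))"
    if "continuous_on {0..a} v" "continuous_on {0..a} w"
      "\<And>t. t \<in> {0..a} \<Longrightarrow> \<bar>v t - w t\<bar> \<le> B * exp (c * t powr (1 - \<beta>))" "x \<in> {0..a}"
    for v w B x
    unfolding D_def by (rule picard_op_contraction[OF assms(1,2) c assms(4) g lip that])
  obtain v where "continuous_on {0..a} v" "\<And>x. x \<in> {0..a} \<Longrightarrow> picard_op \<beta> b g v x = v x"
    and unique: "\<And>w x. continuous_on {0..a} w \<Longrightarrow>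
      (\<And>x. x \<in> {0..a} \<Longrightarrow> picard_op \<beta> b g w x = w x) \<Longrightarrow> x \<in> {0..a} \<Longrightarrow> w x = v x"
    by (rule weighted_contraction[OF assms(3) q powr_weight_continuous[OF assms(2)] \<phi>
          continuous_on_picard_op[OF assms(1,2) _ g] contr]) blast+
  then show thesis
    by (rule that)
qed

text \<open>Continuity of the integrand at \<open>x\<close> suffices for differentiating the
  integral, and \<open>x > 0\<close> stays away from the singularity of
  \<open>t powr (- \<beta>)\<close>.\<close>

lemma picard_op_has_vector_derivative:
  assumes "0 < \<beta>" "\<beta> < 1" "continuous_on {0..a} v"
    and g: "continuous_on ({0..a} \<times> UNIV \<times> UNIV) (\<lambda>(x, t1, t2). g x t1 t2)"
    and x: "x \<in> {0<..a}"
  shows "(picard_op \<beta> b g v has_vector_derivative x powr (- \<beta>) * g x (frac_int \<beta> v x) (v x))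
    (at x within {0..a})"
proof -
  have cont: "continuous_on {0..a} (\<lambda>t. g t (frac_int \<beta> v t) (v t))"
    by (rule continuous_on_picard_integrand[OF assms(1,3) g])
  have "((\<lambda>y. integral {0..y} (\<lambda>t. t powr (- \<beta>) * g t (frac_int \<beta> v t) (v t)))
      has_vector_derivative x powr (- \<beta>) * g x (frac_int \<beta> v x) (v x)) (at x within {0..a} - {})"
  proof (rule integral_has_vector_derivative_continuous_at)
    show "continuous (at x within {0..a} - {}) (\<lambda>t. t powr (- \<beta>) * g t (frac_int \<beta> v t) (v t))"
      using cont x unfolding continuous_on_eq_continuous_within continuous_within
      by (auto intro!: tendsto_mult tendsto_powr tendsto_ident_at)
  qed (use x cont assms(2) powr_mult_integrable in auto)
  then show ?thesis
    unfolding picard_op_def by (auto intro!: derivative_eq_intros)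
qed

subsection \<open>Reduction of the initial value problem\<close>

text \<open>The kernel exponent \<open>- \<beta>\<close> is \<open>(1 - \<beta>) - 1\<close>, so
  \<open>RL_integral\<close> is the fractional integral of order \<open>1 - \<beta>\<close> without
  its normalisation.\<close>

lemma RL_integral_eq_frac_int:
  assumes "\<beta> < 1"
  shows "RL_integral \<beta> \<omega> x = Gamma (1 - \<beta>) * frac_int (1 - \<beta>) \<omega> x"
  using Gamma_real_nonzero[of "1 - \<beta>"] assms
  by (simp add: RL_integral_def frac_int_def powr_minus divide_inverse mult.commute)

lemma RL_integral_frac_int:
  assumes "0 < \<beta>" "\<beta> < 1" "continuous_on {0..a} v" "x \<in> {0..a}"
  shows "RL_integral \<beta> (frac_int \<beta> v) x = Gamma (1 - \<beta>) * integral {0..x} v"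
proof -
  have "continuous_on {0..x} v"
    by (rule continuous_on_subset[OF assms(3)]) (use assms(4) in auto)
  then show ?thesis
    using assms frac_int_complementary[of \<beta> x v] by (simp add: RL_integral_eq_frac_int)
qed

lemma RL_integral_frac_int_has_vector_derivative:
  assumes "0 < \<beta>" "\<beta> < 1" "continuous_on {0..a} v" "x \<in> {0..a}"
  shows "(RL_integral \<beta> (frac_int \<beta> v) has_vector_derivative Gamma (1 - \<beta>) * v x) (at x within {0..a})"
proof (rule has_vector_derivative_transform[OF assms(4)])
  show "((\<lambda>x. Gamma (1 - \<beta>) * integral {0..x} v) has_vector_derivative Gamma (1 - \<beta>) * v x)
      (at x within {0..a})"
    by (intro has_vector_derivative_mult_right integral_has_vector_derivative assms)
qed (use assms RL_integral_frac_int in auto)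

text \<open>Uniqueness of derivatives within a nondegenerate interval turns the preceding relation
  into an equation, which can be used under the second derivative.\<close>

lemma vector_derivative_RL_integral_frac_int:
  assumes "0 < \<beta>" "\<beta> < 1" "continuous_on {0..a} v" "x \<in> {0..a}" "a > 0"
  shows "vector_derivative (RL_integral \<beta> (frac_int \<beta> v)) (at x within {0..a}) = Gamma (1 - \<beta>) * v x"
  using RL_integral_frac_int_has_vector_derivative[OF assms(1-4)] assms(4,5)
  by (intro vector_derivative_within_closed_interval) auto

lemma RL_deriv_frac_int:
  assumes "0 < \<beta>" "\<beta> < 1" "continuous_on {0..a} v" "x \<in> {0..a}" "a > 0"
  shows "RL_deriv \<beta> a (frac_int \<beta> v) x = v x"
  using vector_derivative_RL_integral_frac_int[OF assms] Gamma_real_nonzero[of "1 - \<beta>"] assms(2)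
  by (simp add: RL_deriv_def)

text \<open>Both sides have the same integral of order \<open>1 - \<beta>\<close>: for
  \<open>\<omega>\<close> by the fundamental theorem of calculus, for the right-hand side by
  \<open>frac_int_complementary\<close>. Injectivity of that integral concludes.
  \<open>RL_integral \<beta> \<omega>\<close> is 0 at 0, so no extra term in
  \<open>x powr (\<beta> - 1)\<close> appears.\<close>

lemma C_RL_eq_frac_int_RL_deriv:
  assumes \<beta>: "0 < \<beta>" "\<beta> < 1" and a: "a > 0" and \<omega>: "\<omega> \<in> C_RL \<beta> a" and x: "x \<in> {0..a}"
  shows "\<omega> x = frac_int \<beta> (RL_deriv \<beta> a \<omega>) x"
proof -
  define v where "v = RL_deriv \<beta> a \<omega>"
  have c\<omega>: "continuous_on {0..a} \<omega>" and v: "continuous_on {0..a} v"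
    and diff: "\<And>x. x \<in> {0..a} \<Longrightarrow> RL_integral \<beta> \<omega> differentiable (at x within {0..a})"
    using \<omega> by (auto simp: C_RL_def v_def)
  have J: "continuous_on {0..a} (frac_int \<beta> v)"
    using \<beta>(1) v by (rule continuous_on_frac_int)
  have der: "(RL_integral \<beta> \<omega> has_vector_derivative Gamma (1 - \<beta>) * v y) (at y within {0..a})"
    if "y \<in> {0..a}" for y
    using diff[OF that] Gamma_real_nonzero[of "1 - \<beta>"] \<beta>(2)
    by (simp add: vector_derivative_works v_def RL_deriv_def)
  have "RL_integral \<beta> \<omega> y = RL_integral \<beta> (frac_int \<beta> v) y" if y: "y \<in> {0..a}" for y
  proof -
    have "((\<lambda>y. Gamma (1 - \<beta>) * v y) has_integral RL_integral \<beta> \<omega> y - RL_integral \<beta> \<omega> 0) {0..y}"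
    proof (rule fundamental_theorem_of_calculus)
      show "(RL_integral \<beta> \<omega> has_vector_derivative Gamma (1 - \<beta>) * v z) (at z within {0..y})"
        if "z \<in> {0..y}" for z
        using that y by (intro has_vector_derivative_within_subset[OF der]) auto
    qed (use y in auto)
    from integral_unique[OF this] have "RL_integral \<beta> \<omega> y = Gamma (1 - \<beta>) * integral {0..y} v"
      by (simp add: RL_integral_def[of _ _ 0])
    then show ?thesis
      using RL_integral_frac_int[OF \<beta> v y] by simp
  qed
  then have "frac_int (1 - \<beta>) (\<lambda>t. \<omega> t - frac_int \<beta> v t) y = 0" if "y \<in> {0..a}" for y
    using that \<beta> Gamma_real_nonzero[of "1 - \<beta>"] continuous_on_subset[OF c\<omega>, of "{0..y}"]
      continuous_on_subset[OF J, of "{0..y}"]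
    by (subst frac_int_diff) (auto simp: RL_integral_eq_frac_int)
  then have "\<omega> x - frac_int \<beta> v x = 0"
    using \<beta> a x c\<omega> J
    by (intro frac_int_eq_0_imp[of "1 - \<beta>" a "\<lambda>t. \<omega> t - frac_int \<beta> v t"]) (auto intro: continuous_on_diff)
  then show ?thesis by (simp add: v_def)
qed

section \<open>Equivalence of the initial value problem and the fixed-point equation\<close>

lemma weighted_eq:
  assumes "x > 0"
  shows "x powr (- (\<sigma> - 1)) * weighted \<sigma> f x s t = f x s t"
  using assms by (simp add: weighted_def powr_minus del: minus_diff_eq)

text \<open>For \<open>v = RL_deriv (\<sigma> - 1) a \<omega>\<close> the problem reads
  \<open>v' = f\<close> on \<open>{0<..a}\<close> with \<open>v 0 = b\<close>. Integrating from 0,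
  after splitting \<open>f\<close> into \<open>y powr (- \<beta>)\<close> and its weighted form,
  gives the claim.\<close>

lemma solves_ivp_imp_picard:
  assumes \<sigma>: "1 < \<sigma>" "\<sigma> < 2" and a: "a > 0"
    and \<omega>: "\<omega> \<in> C_RL (\<sigma> - 1) a" and sol: "solves_ivp \<sigma> b f a \<omega>" and x: "x \<in> {0..a}"
  shows "picard_op (\<sigma> - 1) b (weighted \<sigma> f) (RL_deriv (\<sigma> - 1) a \<omega>) x = RL_deriv (\<sigma> - 1) a \<omega> x"
proof -
  define \<beta> where "\<beta> = \<sigma> - 1"
  define v where "v = RL_deriv \<beta> a \<omega>"
  have \<beta>: "0 < \<beta>" "\<beta> < 1" using \<sigma> by (auto simp: \<beta>_def)
  have \<omega>v: "\<omega> y = frac_int \<beta> v y" if "y \<in> {0..a}" for y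
    using C_RL_eq_frac_int_RL_deriv[OF \<beta> a _ that] \<omega> by (simp add: v_def \<beta>_def)
  have v: "continuous_on {0..a} v" using \<omega> by (simp add: C_RL_def v_def \<beta>_def)
  have "v 0 = b" using sol by (simp add: solves_ivp_def v_def \<beta>_def)
  have der: "(v has_vector_derivative y powr (- \<beta>) * weighted \<sigma> f y (frac_int \<beta> v y) (v y)) (at y)"
    if y: "y \<in> {0<..<x}" for y
  proof -
    have ya: "y \<in> {0<..a}" "y \<in> {0..a}" using y x by auto
    let ?D = "\<lambda>y. vector_derivative (RL_integral \<beta> \<omega>) (at y within {0..a})"
    have "?D differentiable (at y within {0..a})"
      using sol ya(1) unfolding solves_ivp_def RL_deriv2_exists_def \<beta>_def by blast
    then have "(?D has_vector_derivative vector_derivative ?D (at y within {0..a})) (at y within {0..a})"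
      by (simp add: vector_derivative_works)
    then have "((\<lambda>y. 1 / Gamma (1 - \<beta>) * ?D y) has_vector_derivative
        1 / Gamma (1 - \<beta>) * vector_derivative ?D (at y within {0..a})) (at y within {0..a})"
      by (rule has_vector_derivative_mult_right)
    moreover have "1 / Gamma (1 - \<beta>) * vector_derivative ?D (at y within {0..a}) = f y (\<omega> y) (v y)"
      using sol ya(1) unfolding solves_ivp_def RL_deriv2_def v_def \<beta>_def by simp
    ultimately have "(v has_vector_derivative f y (\<omega> y) (v y)) (at y within {0..a})"
      by (simp add: v_def RL_deriv_def[abs_def])
    moreover have "at y within {0..a} = at y"
      using y x by (intro at_within_interior) auto
    ultimately show ?thesis
      using weighted_eq[of y \<sigma> f "\<omega> y" "v y"] y \<omega>v[OF ya(2)] by (simp add: \<beta>_def)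
  qed
  \<comment> \<open>Continuity of \<open>v\<close> up to 0 and the derivative inside the interval
    suffice; integrability of the singular integrand is part of the conclusion.\<close>
  have "((\<lambda>y. y powr (- \<beta>) * weighted \<sigma> f y (frac_int \<beta> v y) (v y)) has_integral v x - v 0) {0..x}"
    using x v der
    by (intro fundamental_theorem_of_calculus_interior) (auto intro: continuous_on_subset)
  from integral_unique[OF this] have "picard_op \<beta> b (weighted \<sigma> f) v x = v x"
    using \<open>v 0 = b\<close> by (simp add: picard_op_def)
  then show ?thesis by (simp add: v_def \<beta>_def)
qed

text \<open>As \<open>v\<close> is the \<open>RL_deriv\<close> of its own fractional integral,
  differentiating the fixed-point equation at \<open>x > 0\<close> yields the differential equation,
  the power and the weight recombining to \<open>f\<close>.\<close>

lemma picard_imp_solves_ivp: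
  assumes \<sigma>: "1 < \<sigma>" "\<sigma> < 2" and a: "a > 0"
    and g: "continuous_on ({0..a} \<times> UNIV \<times> UNIV) (\<lambda>(x, t1, t2). weighted \<sigma> f x t1 t2)"
    and v: "continuous_on {0..a} v"
    and fp: "\<And>x. x \<in> {0..a} \<Longrightarrow> picard_op (\<sigma> - 1) b (weighted \<sigma> f) v x = v x"
  shows "frac_int (\<sigma> - 1) v \<in> C_RL (\<sigma> - 1) a" "solves_ivp \<sigma> b f a (frac_int (\<sigma> - 1) v)"
proof -
  define \<beta> where "\<beta> = \<sigma> - 1"
  have \<beta>: "0 < \<beta>" "\<beta> < 1" using \<sigma> by (auto simp: \<beta>_def)
  have G: "Gamma (1 - \<beta>) \<noteq> 0" using Gamma_real_nonzero[of "1 - \<beta>"] \<beta> by simp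
  let ?\<omega> = "frac_int \<beta> v"
  have D: "RL_deriv \<beta> a ?\<omega> x = v x" if "x \<in> {0..a}" for x
    using RL_deriv_frac_int[OF \<beta> v that a] .
  have "continuous_on {0..a} (RL_deriv \<beta> a ?\<omega>)"
    using v D by (metis (no_types, lifting) continuous_on_cong)
  then have "?\<omega> \<in> C_RL \<beta> a"
    using continuous_on_frac_int[OF \<beta>(1) v]
      RL_integral_frac_int_has_vector_derivative[OF \<beta> v, THEN differentiableI_vector]
    by (simp add: C_RL_def)
  then show "frac_int (\<sigma> - 1) v \<in> C_RL (\<sigma> - 1) a" by (simp add: \<beta>_def)
  \<comment> \<open>At 0 the integral in \<open>picard_op\<close> runs over a single point.\<close>
  have "v 0 = b" using fp[of 0] a by (simp add: picard_op_def)
  let ?D = "\<lambda>y. vector_derivative (RL_integral \<beta> ?\<omega>) (at y within {0..a})"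
  \<comment> \<open>The first derivative is a multiple of \<open>picard_op\<close> on all of
    \<open>{0..a}\<close>, not only at \<open>x\<close>, so it can be replaced before
    differentiating again.\<close>
  have der: "(?D has_vector_derivative Gamma (1 - \<beta>) * f x (?\<omega> x) (v x)) (at x within {0..a})"
    if x: "x \<in> {0<..a}" for x
  proof (rule has_vector_derivative_transform)
    have "(picard_op \<beta> b (weighted \<sigma> f) v has_vector_derivative f x (?\<omega> x) (v x)) (at x within {0..a})"
      using picard_op_has_vector_derivative[OF \<beta> v g x, of b] weighted_eq[of x \<sigma> f] x
      by (simp add: \<beta>_def)
    then show "((\<lambda>y. Gamma (1 - \<beta>) * picard_op \<beta> b (weighted \<sigma> f) v y) has_vector_derivative
        Gamma (1 - \<beta>) * f x (?\<omega> x) (v x)) (at x within {0..a})"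
      by (rule has_vector_derivative_mult_right)
    show "?D y = Gamma (1 - \<beta>) * picard_op \<beta> b (weighted \<sigma> f) v y" if "y \<in> {0..a}" for y
      using vector_derivative_RL_integral_frac_int[OF \<beta> v that a] fp[OF that] by (simp add: \<beta>_def)
  qed (use x in auto)
  have eq: "RL_deriv2_exists \<sigma> a ?\<omega> x \<and> RL_deriv2 \<sigma> a ?\<omega> x = f x (?\<omega> x) (RL_deriv \<beta> a ?\<omega> x)"
    if x: "x \<in> {0<..a}" for x
  proof
    show "RL_deriv2_exists \<sigma> a ?\<omega> x"
      using der[OF x] unfolding RL_deriv2_exists_def \<beta>_def by (rule differentiableI_vector)
    have "vector_derivative ?D (at x within {0..a}) = Gamma (1 - \<beta>) * f x (?\<omega> x) (v x)"
      using der[OF x] x a by (intro vector_derivative_within_closed_interval) auto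
    then show "RL_deriv2 \<sigma> a ?\<omega> x = f x (?\<omega> x) (RL_deriv \<beta> a ?\<omega> x)"
      using G D[of x] x by (simp add: RL_deriv2_def \<beta>_def)
  qed
  then show "solves_ivp \<sigma> b f a (frac_int (\<sigma> - 1) v)"
    using D[of 0] a \<open>v 0 = b\<close> by (auto simp: solves_ivp_def \<beta>_def frac_int_def)
qed

text \<open>The second summand of \<open>C_const\<close> is positive, so the quotient
  \<open>r / C_const b \<sigma> M\<close> is positive, and with it every branch. This makes
  \<open>{0..a}\<close> nondegenerate in the theorem.\<close>

lemma existence_time_pos:
  assumes "1 < \<sigma>" "\<sigma> < 2" "T > 0" "r > 0" "M > 0"
  shows "existence_time \<sigma> b T r M > 0"
proof -
  have "M * ((1 + Gamma (3 - \<sigma>)) / (2 - \<sigma>)) > 0"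
    using assms Gamma_real_pos[of "3 - \<sigma>"] by (intro mult_pos_pos divide_pos_pos add_pos_pos) auto
  moreover have "\<bar>b\<bar> / Gamma \<sigma> \<ge> 0" using assms by simp
  ultimately have "r / C_const b \<sigma> M > 0"
    using assms by (simp add: C_const_def add_nonneg_pos)
  then show ?thesis
    using assms by (auto simp: existence_time_def Let_def)
qed

theorem theorem3p3:
  fixes \<sigma> T b r M L C \<alpha> a :: real
    and f :: "real \<Rightarrow> real \<Rightarrow> real \<Rightarrow> real"
  assumes "1 < \<sigma>" and "\<sigma> < 2" and "T > 0" and "b \<noteq> 0"
    and "continuous_on ({0<..T} \<times> UNIV \<times> UNIV) (\<lambda>(x, t1, t2). f x t1 t2)"
    and "continuous_on ({0..T} \<times> UNIV \<times> UNIV) (\<lambda>(x, t1, t2). weighted \<sigma> f x t1 t2)"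
    and "r > 0" and "M > 0"
    and "\<And>r1 r2 x w v. \<lbrakk>r1 \<ge> 0; r2 \<ge> 0; r1 + r2 \<le> r; x \<in> {0..T};
            w \<in> {-r1..r1}; v \<in> {b - r2..b + r2}\<rbrakk> \<Longrightarrow> \<bar>weighted \<sigma> f x w v\<bar> \<le> M"
    and "L > 0"
    and "\<And>x t11 t21 t12 t22. x \<in> {0..T} \<Longrightarrow>
           \<bar>weighted \<sigma> f x t11 t21 - weighted \<sigma> f x t12 t22\<bar>
             \<le> L / 2 * (\<bar>t11 - t12\<bar> + \<bar>t21 - t22\<bar>)"
    and "C > 0" and "0 < \<alpha>" and "\<alpha> < 1"
    and "(1 - \<sigma>) * (1 - \<alpha>) - L * (1 - \<alpha>) + 1 > 0"
    and "\<And>x t11 t21 t12 t22. x \<in> {0..T} \<Longrightarrow>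
           \<bar>weighted \<sigma> f x t11 t21 - weighted \<sigma> f x t12 t22\<bar>
             \<le> C * (\<bar>t11 - t12\<bar> powr \<alpha> + x powr (\<alpha> * (\<sigma> - 1)) * \<bar>t21 - t22\<bar> powr \<alpha>)"
    and "a = min (T0_star \<sigma> b T r M) T"
  shows "\<exists>\<omega>\<in>C_RL (\<sigma> - 1) a. solves_ivp \<sigma> b f a \<omega> \<and>
           (\<forall>\<eta>\<in>C_RL (\<sigma> - 1) a. solves_ivp \<sigma> b f a \<eta> \<longrightarrow> (\<forall>x\<in>{0..a}. \<eta> x = \<omega> x))"
proof -
  have a: "a > 0" "a \<le> T"
    using existence_time_pos[of \<sigma> T r M b] assms(1-3,7,8,17) by (auto simp: T0_star_def)
  have \<beta>: "0 < \<sigma> - 1" "\<sigma> - 1 < 1" using assms(1,2) by auto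
  have g: "continuous_on ({0..a} \<times> UNIV \<times> UNIV) (\<lambda>(x, t1, t2). weighted \<sigma> f x t1 t2)"
    using a by (intro continuous_on_subset[OF assms(6)]) auto
  have lip: "\<bar>weighted \<sigma> f x s t - weighted \<sigma> f x s' t'\<bar> \<le> L / 2 * (\<bar>s - s'\<bar> + \<bar>t - t'\<bar>)"
    if "x \<in> {0..a}" for x s t s' t'
    using assms(11)[of x s t s' t'] that a by simp
  have nonneg: "a \<ge> 0" "L / 2 \<ge> 0" using a assms(10) by auto
  obtain v where v: "continuous_on {0..a} v"
      "\<And>x. x \<in> {0..a} \<Longrightarrow> picard_op (\<sigma> - 1) b (weighted \<sigma> f) v x = v x"
    and unique: "\<And>w x. continuous_on {0..a} w \<Longrightarrow>
      (\<And>x. x \<in> {0..a} \<Longrightarrow> picard_op (\<sigma> - 1) b (weighted \<sigma> f) w x = w x) \<Longrightarrow>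
      x \<in> {0..a} \<Longrightarrow> w x = v x"
    by (rule picard_op_unique_fixed_point[OF \<beta> nonneg g lip, of b]) blast+
  show ?thesis
  proof (intro bexI[of _ "frac_int (\<sigma> - 1) v"] conjI ballI impI)
    fix \<eta> x assume \<eta>: "\<eta> \<in> C_RL (\<sigma> - 1) a" "solves_ivp \<sigma> b f a \<eta>" and x: "x \<in> {0..a}"
    have "continuous_on {0..a} (RL_deriv (\<sigma> - 1) a \<eta>)"
      using \<eta>(1) by (simp add: C_RL_def)
    \<comment> \<open>The derivative of any solution is a continuous fixed point, hence
      \<open>v\<close>; the fractional integral then recovers the solution itself.\<close>
    then have "RL_deriv (\<sigma> - 1) a \<eta> t = v t" if "t \<in> {0..a}" for t
      using solves_ivp_imp_picard[OF assms(1,2) a(1) \<eta>] that by (rule unique)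
    then show "\<eta> x = frac_int (\<sigma> - 1) v x"
      using x frac_int_cong[of x "RL_deriv (\<sigma> - 1) a \<eta>" v "\<sigma> - 1"]
      by (subst C_RL_eq_frac_int_RL_deriv[OF \<beta> a(1) \<eta>(1) x]) auto
  qed (rule picard_imp_solves_ivp[OF assms(1,2) a(1) g v]; assumption)+
qed

end
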